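(* Let $m,n$ be nonnegative integers. (i) $\zeta^\star(\{2\}^n,3,\{2\}^m,1)+\zeta^\star(\{2\}^m,3,\{2\}^n,1)=\zeta^\star(\{2\}^{n+1})\,\zeta^\star(\{2\}^{m+1})$. (ii) $(2n+1)\,\zeta^\star(\{3,1\}^n,2)=\sum_{j+k=n,\ j,k\ge0}\zeta^\star(\{3,1\}^j)\,\zeta^\star(\{2\}^{2k+1})$. (iii) If $n\ge1$, then \[\sum_{\substack{e_1+e_2+\cdots+e_{2n}=1\\ e_1,\dots,e_{2n}\ge0}}\zeta^\star(\{2\}^{e_1},3,\{2\}^{e_2},1,\dots,\{2\}^{e_{2n-1}},3,\{2\}^{e_{2n}},1)=\sum_{j+k=n-1,\ j,k\ge0}\zeta^\star(\{3,1\}^j,2)\,\zeta^\star(\{2\}^{2k+2}).\]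
   Context: For a composition $\mathbf{s}=(s_1,\dots,s_\ell)$ of positive integers with $s_1\ge2$, $\zeta^\star(\mathbf{s})=\sum_{k_1\ge k_2\ge\cdots\ge k_\ell\ge1}\prod_{i=1}^\ell k_i^{-s_i}$, and $\zeta^\star(\emptyset)=1$. $\{x\}^a$ (resp. $\{3,1\}^j$) denotes $a$ consecutive copies of $x$ (resp. $j$ consecutive copies of the pair $3,1$), empty if the exponent is $0$. *)

theory Defs
  imports "HOL-Analysis.Analysis"
begin

text \<open>
  The series converges (all terms are nonnegative) when \<open>s\<close> is empty or a list of positive
  integers whose head is at least 2. It is only meant to be used for such \<open>s\<close>; on other lists
  \<open>infsum\<close> may return its default value 0.
\<close>

definition zeta_star :: "nat list \<Rightarrow> real" where
  "zeta_star s =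
     (\<Sum>\<^sub>\<infinity>k\<in>{k :: nat list. length k = length s \<and> sorted_wrt (\<ge>) k \<and> (\<forall>x\<in>set k. 1 \<le> x)}.
        \<Prod>i<length s. 1 / real (k ! i) ^ (s ! i))"

lemma zeta_star_Nil: "zeta_star [] = 1"
proof -
  have "{k :: nat list. length k = length ([] :: nat list) \<and> sorted_wrt (\<ge>) k \<and> (\<forall>x\<in>set k. 1 \<le> x)} = {[]}"
    by auto
  then show ?thesis
    unfolding zeta_star_def by simp
qed

abbreviation rep31 :: "nat \<Rightarrow> nat list" where
  "rep31 j \<equiv> concat (replicate j [3, 1])"

text \<open>
  For \<open>e = [e\<^sub>1, \<dots>, e\<^sub>2\<^sub>n]\<close> this is \<open>{2}^e\<^sub>1, 3, {2}^e\<^sub>2, 1, \<dots>, {2}^e\<^sub>2\<^sub>n\<^sub>-\<^sub>1, 3, {2}^e\<^sub>2\<^sub>n, 1\<close>;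
  list positions are counted from 0, so \<open>e\<^sub>1\<close> is \<open>e ! 0\<close>.
\<close>

definition insert2_31 :: "nat \<Rightarrow> nat list \<Rightarrow> nat list" where
  "insert2_31 n e =
     concat (map (\<lambda>i. replicate (e ! (2 * i)) 2 @ [3] @ replicate (e ! (2 * i + 1)) 2 @ [1]) [0..<n])"

end

theory Submission
  imports Defs "HOL-Computational_Algebra.Formal_Power_Series"
begin

text \<open>
  Write a truncated star sum as \<open>g N = (\<Sum>k\<le>N. C\<^sub>N(k) a\<^sub>k)\<close> with
  \<open>C\<^sub>N(k) = (N choose k) / (N + k choose k)\<close>. Prefixing an exponent \<open>s\<close> replaces \<open>g N\<close> by
  \<open>\<Sum>j=1..N. g j / j ^ s\<close>, and on the coefficients \<open>a\<close> this acts by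
  \<^item> \<open>s = 2\<close>: \<open>a\<^sub>k / k\<^sup>2\<close>,
  \<^item> \<open>s = 1\<close>: \<open>(U a)\<^sub>k / k\<close>, where \<open>(U a)\<^sub>k = a\<^sub>k + 2 (a\<^sub>1 + \<dots> + a\<^bsub>k-1\<^esub>)\<close>,
  \<^item> \<open>s = 3\<close>: \<open>(-1) ^ k (U b)\<^sub>k / k\<^sup>2\<close>, where \<open>b\<^sub>k = (-1) ^ k a\<^sub>k / k\<close>.

  As \<open>C\<^sub>N(k) \<rightarrow> 1\<close>, every zeta star value in the theorem equals, up to sign, an alternating sum of
  \<open>2 ^ #{k\<^sub>1, \<dots>, k\<^sub>r} \<Prod>i. (-1) ^ k\<^sub>i / k\<^sub>i ^ (2 e\<^sub>i + 2)\<close> over \<open>k\<^sub>1 \<ge> \<dots> \<ge> k\<^sub>r \<ge> 1\<close>. For such sums the first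
  identity is a discrete product rule. If all \<open>e\<^sub>i\<close> vanish, their generating function is
  \<open>\<Prod>k. (1 + x\<^sub>k t) / (1 - x\<^sub>k t)\<close> with \<open>x\<^sub>k = (-1) ^ k / k\<^sup>2\<close>, and the other two identities are its
  logarithmic derivatives along \<open>x\<^sub>k \<mapsto> x\<^sub>k\<close> and \<open>x\<^sub>k \<mapsto> x\<^sub>k / k\<^sup>2\<close>.
\<close>

subsection \<open>Truncated star sums\<close>

primrec star_sum :: "nat list \<Rightarrow> nat \<Rightarrow> real" where
  "star_sum [] N = 1"
| "star_sum (s # ss) N = (\<Sum>k=1..N. star_sum ss k / real k ^ s)"

definition star_indices :: "nat \<Rightarrow> nat \<Rightarrow> nat list set" where
  "star_indices l N = {k. length k = l \<and> sorted_wrt (\<ge>) k \<and> set k \<subseteq> {1..N}}"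

lemma star_indices_0: "star_indices 0 N = {[]}"
  by (auto simp: star_indices_def)

lemma star_indices_Suc:
  "star_indices (Suc l) N = (\<lambda>(x, k). x # k) ` (SIGMA x:{1..N}. star_indices l x)"
proof -
  have "k \<in> star_indices (Suc l) N \<longleftrightarrow>
      k \<in> (\<lambda>(x, k). x # k) ` (SIGMA x:{1..N}. star_indices l x)" for k
    by (cases k) (fastforce simp: star_indices_def image_iff)+
  then show ?thesis by blast
qed

lemma finite_star_indices: "finite (star_indices l N)"
  by (induction l arbitrary: N) (auto simp: star_indices_0 star_indices_Suc)

lemma sum_star_indices:
  "(\<Sum>k\<in>star_indices (length s) N. \<Prod>i<length s. 1 / real (k ! i) ^ (s ! i)) = star_sum s N"
proof (induction s arbitrary: N)
  case Nil
  then show ?case by (simp add: star_indices_0)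
next
  case (Cons a s)
  have inj: "inj_on (\<lambda>(x, k). x # k) (SIGMA x:{1..N}. star_indices (length s) x)"
    by (auto simp: inj_on_def)
  have "(\<Sum>k\<in>star_indices (length (a # s)) N. \<Prod>i<length (a # s). 1 / real (k ! i) ^ ((a # s) ! i))
     = (\<Sum>(x, k)\<in>(SIGMA x:{1..N}. star_indices (length s) x).
          1 / real x ^ a * (\<Prod>i<length s. 1 / real (k ! i) ^ (s ! i)))"
    unfolding length_Cons star_indices_Suc sum.reindex[OF inj]
    by (simp add: prod.lessThan_Suc_shift case_prod_unfold del: prod.lessThan_Suc)
  also have "\<dots> = (\<Sum>x=1..N. \<Sum>k\<in>star_indices (length s) x.
          1 / real x ^ a * (\<Prod>i<length s. 1 / real (k ! i) ^ (s ! i)))"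
    by (rule sum.Sigma[symmetric]) (auto simp: finite_star_indices)
  also have "\<dots> = star_sum (a # s) N"
    unfolding sum_distrib_left[symmetric] Cons.IH by simp
  finally show ?case .
qed

text \<open>A finite set of index lists has a largest entry, and \<open>star_indices l N\<close>
  contains the set once \<open>N\<close> reaches it. So an unordered sum, once it exists, is the
  limit along these boxes.\<close>

lemma filterlim_star_indices:
  "filterlim (star_indices l)
     (finite_subsets_at_top {k. length k = l \<and> sorted_wrt (\<ge>) k \<and> (\<forall>x\<in>set k. 1 \<le> x)}) sequentially"
  unfolding filterlim_finite_subsets_at_top
proof (intro allI impI)
  fix X :: "nat list set"
  assume X: "finite X \<and> X \<subseteq> {k. length k = l \<and> sorted_wrt (\<ge>) k \<and> (\<forall>x\<in>set k. 1 \<le> x)}"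
  \<comment> \<open>Inserting 0 keeps the maximum defined when no list in \<open>X\<close> has an
    entry.\<close>
  define M where "M = Max (insert 0 (\<Union>(set ` X)))"
  have "x \<le> M" if "k \<in> X" "x \<in> set k" for k x
    unfolding M_def using X that by (intro Max_ge) auto
  then have "finite (star_indices l N) \<and> X \<subseteq> star_indices l N \<and>
      star_indices l N \<subseteq> {k. length k = l \<and> sorted_wrt (\<ge>) k \<and> (\<forall>x\<in>set k. 1 \<le> x)}" if "N \<ge> M" for N
    using X that finite_star_indices[of l N] by (fastforce simp: star_indices_def)
  then show "\<forall>\<^sub>F N in sequentially. finite (star_indices l N) \<and> X \<subseteq> star_indices l N \<and>
      star_indices l N \<subseteq> {k. length k = l \<and> sorted_wrt (\<ge>) k \<and> (\<forall>x\<in>set k. 1 \<le> x)}"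
    unfolding eventually_sequentially by blast
qed

lemma star_sum_mono: "M \<le> N \<Longrightarrow> star_sum s M \<le> star_sum s N"
proof -
  assume "M \<le> N"
  then have "star_indices (length s) M \<subseteq> star_indices (length s) N"
    by (auto simp: star_indices_def)
  then show ?thesis
    unfolding sum_star_indices[symmetric]
    by (intro sum_mono2 finite_star_indices) (auto intro!: prod_nonneg)
qed

text \<open>All terms are nonnegative, so the truncations increase to \<open>L\<close>, which bounds
  every finite partial sum. This gives summability, hence \<open>infsum\<close> is a genuine sum and
  not its default 0.\<close>

lemma zeta_star_eqI:
  assumes "star_sum s \<longlonglongrightarrow> L"
  shows "zeta_star s = L"
proof -
  let ?I = "{k. length k = length s \<and> sorted_wrt (\<ge>) k \<and> (\<forall>x\<in>set k. 1 \<le> x)}"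
  let ?f = "\<lambda>k. \<Prod>i<length s. 1 / real (k ! i) ^ (s ! i)"
  have le: "star_sum s N \<le> L" for N
    using assms star_sum_mono by (intro incseq_le) (auto simp: incseq_def)
  have "?f summable_on ?I"
  proof (rule nonneg_bounded_partial_sums_imp_summable_on)
    show "\<forall>\<^sub>F X in finite_subsets_at_top ?I. sum ?f X \<le> L"
    proof (rule eventually_finite_subsets_at_top_weakI)
      fix X :: "nat list set"
      assume X: "finite X" "X \<subseteq> ?I"
      have "\<forall>\<^sub>F N in sequentially. X \<subseteq> star_indices (length s) N"
        using filterlim_star_indices[of "length s", unfolded filterlim_finite_subsets_at_top,
            rule_format, OF conjI[OF X]]
        by (rule eventually_mono) simp
      then obtain N where "X \<subseteq> star_indices (length s) N"
        using eventually_happens'[OF sequentially_bot] by blast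
      then have "sum ?f X \<le> star_sum s N"
        unfolding sum_star_indices[symmetric]
        by (intro sum_mono2 finite_star_indices) (auto intro!: prod_nonneg)
      then show "sum ?f X \<le> L"
        using le order_trans by blast
    qed
  qed (auto intro!: prod_nonneg)
  then have "(?f has_sum zeta_star s) ?I"
    unfolding zeta_star_def by simp
  then have "(\<lambda>N. sum ?f (star_indices (length s) N)) \<longlonglongrightarrow> zeta_star s"
    unfolding has_sum_def by (rule filterlim_compose) (rule filterlim_star_indices)
  then show ?thesis
    using assms LIMSEQ_unique by (simp add: sum_star_indices)
qed

subsection \<open>Expansion in binomial quotients\<close>

text \<open>Equals \<open>(N choose k) / (N + k choose k)\<close>.\<close>

definition choose_ratio :: "nat \<Rightarrow> nat \<Rightarrow> real" where
  "choose_ratio N k = (\<Prod>i<k. (real N - real i) / (real N + real i + 1))"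

lemma choose_ratio_0 [simp]: "choose_ratio N 0 = 1"
  by (simp add: choose_ratio_def)

lemma choose_ratio_eq_0: "N < k \<Longrightarrow> choose_ratio N k = 0"
  by (auto simp: choose_ratio_def)

lemma choose_ratio_Suc:
  "choose_ratio N (Suc k) * (real N + real (Suc k)) = choose_ratio N k * (real N - real k)"
  by (simp add: choose_ratio_def add.assoc add_nonneg_eq_0_iff field_simps)

lemma abs_choose_ratio_le_1: "\<bar>choose_ratio N k\<bar> \<le> 1"
proof (cases "N < k")
  case False
  then have "0 \<le> choose_ratio N k \<and> choose_ratio N k \<le> 1"
    unfolding choose_ratio_def by (auto intro!: prod_nonneg prod_le_1 divide_nonneg_nonneg)
  then show ?thesis by simp
qed (simp add: choose_ratio_eq_0)

lemma tendsto_choose_ratio: "(\<lambda>N. choose_ratio N k) \<longlonglongrightarrow> 1"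
proof -
  have "(\<lambda>N. (real N - real i) / (real N + real i + 1)) \<longlonglongrightarrow> 1" for i
  proof -
    have "filterlim (\<lambda>N. real N + (real i + 1)) at_top sequentially"
      by (rule filterlim_at_top_mono[OF filterlim_real_sequentially]) auto
    then have "(\<lambda>N. 1 - (2 * real i + 1) * inverse (real N + (real i + 1))) \<longlonglongrightarrow> 1 - (2 * real i + 1) * 0"
      by (intro tendsto_intros tendsto_inverse_0_at_top)
    moreover have "(real N - real i) / (real N + real i + 1)
        = 1 - (2 * real i + 1) * inverse (real N + (real i + 1))" for N
      by (simp add: field_simps add_nonneg_eq_0_iff)
    ultimately show ?thesis by simp
  qed
  then have "(\<lambda>N. choose_ratio N k) \<longlonglongrightarrow> (\<Prod>i<k. 1)"
    unfolding choose_ratio_def by (intro tendsto_prod)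
  then show ?thesis by simp
qed

text \<open>The product form also covers \<open>k = Suc N\<close>, where both sides vanish.\<close>

lemma choose_ratio_pred:
  "choose_ratio (Suc N) k * ((real (Suc N))\<^sup>2 - (real k)\<^sup>2) = (real (Suc N))\<^sup>2 * choose_ratio N k"
proof (induction k)
  case (Suc k)
  define M :: real where "M = real (Suc N)"
  have M: "real N = M - 1" "M > 0" by (simp_all add: M_def)
  have 1: "choose_ratio (Suc N) (Suc k) = choose_ratio (Suc N) k * (M - k) / (M + k + 1)"
    by (simp add: choose_ratio_def M_def)
  have 2: "choose_ratio N (Suc k) = choose_ratio N k * (M - 1 - k) / (M + k)"
    by (simp add: choose_ratio_def M algebra_simps)
  have "M\<^sup>2 * choose_ratio N (Suc k) = choose_ratio (Suc N) k * (M\<^sup>2 - (real k)\<^sup>2) * (M - 1 - k) / (M + k)"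
    using Suc[folded M_def] by (simp add: 2)
  also have "\<dots> = choose_ratio (Suc N) k * (M - k) * (M - 1 - k)"
    using M by (simp add: field_simps power2_eq_square)
  also have "\<dots> = choose_ratio (Suc N) (Suc k) * (M\<^sup>2 - (real (Suc k))\<^sup>2)"
    using M by (simp add: 1 divide_simps) (simp add: algebra_simps power2_eq_square)
  finally show ?case unfolding M_def ..
qed (simp)

text \<open>Differencing in \<open>N\<close> multiplies each term by \<open>k^2 / (Suc N)^2\<close>;
  hence prefixing 2 divides the coefficients by \<open>k^2\<close>.\<close>

lemma choose_ratio_diff:
  "choose_ratio (Suc N) k - choose_ratio N k = choose_ratio (Suc N) k * (real k)\<^sup>2 / (real (Suc N))\<^sup>2"
  using choose_ratio_pred[of N k] by (simp add: divide_simps) (simp add: algebra_simps)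

text \<open>Summation by parts: by \<open>choose_ratio_Suc\<close> the difference of the two
  summands telescopes.\<close>

lemma choose_ratio_telescope_1:
  fixes B :: "nat \<Rightarrow> real"
  shows "(\<Sum>k=1..N. choose_ratio N k * real k * (B k + B (k - 1)))
    = real N * (B 0 + (\<Sum>k=1..N. choose_ratio N k * (B k - B (k - 1))))"
proof -
  define C where "C = choose_ratio N"
  \<comment> \<open>The upper limit \<open>n\<close> is freed from \<open>N\<close> for the
    induction; the boundary term vanishes at \<open>n = N\<close>.\<close>
  have "(\<Sum>k=1..n. C k * real k * (B k + B (k - 1)))
      = real N * (B 0 + (\<Sum>k=1..n. C k * (B k - B (k - 1)))) - C n * (real N - real n) * B n" for n
  proof (induction n)
    case (Suc n)
    have "C n * (real N - real n) * B n = C (Suc n) * (real N + real (Suc n)) * B n"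
      using choose_ratio_Suc[of N n] by (simp add: C_def)
    then show ?case using Suc by (simp add: algebra_simps)
  qed (simp add: C_def)
  from this[of N] show ?thesis by (simp add: C_def)
qed

text \<open>The same telescoping with alternating signs, which moves the factor \<open>k\<close>
  from the sums of \<open>B\<close> to its differences.\<close>

lemma choose_ratio_telescope_2:
  fixes B :: "nat \<Rightarrow> real"
  shows "real N * (\<Sum>k=1..N. choose_ratio N k * (-1) ^ k * (B k + B (k - 1)))
    = (\<Sum>k=1..N. choose_ratio N k * (-1) ^ k * real k * (B k - B (k - 1))) - real N * B 0"
proof -
  define C where "C = choose_ratio N"
  have "real N * (\<Sum>k=1..n. C k * (-1) ^ k * (B k + B (k - 1)))
      = (\<Sum>k=1..n. C k * (-1) ^ k * real k * (B k - B (k - 1))) - real N * B 0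
        + (-1) ^ n * C n * (real N - real n) * B n" for n
  proof (induction n)
    case (Suc n)
    have "(-1) ^ n * (C n * (real N - real n)) * B n
        = (-1) ^ n * (C (Suc n) * (real N + real (Suc n))) * B n"
      using choose_ratio_Suc[of N n] by (simp add: C_def)
    then show ?case using Suc by (simp add: algebra_simps)
  qed (simp add: C_def)
  from this[of N] show ?thesis by (simp add: C_def)
qed

text \<open>The solution \<open>g\<close> of \<open>g N - g (N - 1) = star_sum s N / N ^ a\<close>, sought in the form
  \<open>g N = (\<Sum>k. choose_ratio N k * \<beta> k)\<close>.\<close>

lemma star_sum_ConsI:
  assumes "\<And>N. N \<ge> 1 \<Longrightarrow> star_sum s N / real N ^ a
      = (\<Sum>k=1..N. choose_ratio N k * (real k)\<^sup>2 * \<beta> k) / (real N)\<^sup>2"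
  shows "star_sum (a # s) N = (\<Sum>k=1..N. choose_ratio N k * \<beta> k)"
proof (induction N)
  case (Suc N)
  have "(\<Sum>k=1..Suc N. choose_ratio (Suc N) k * \<beta> k)
      = (\<Sum>k=1..Suc N. choose_ratio N k * \<beta> k
          + choose_ratio (Suc N) k * (real k)\<^sup>2 * \<beta> k / (real (Suc N))\<^sup>2)"
  proof (rule sum.cong)
    fix k
    show "choose_ratio (Suc N) k * \<beta> k = choose_ratio N k * \<beta> k
          + choose_ratio (Suc N) k * (real k)\<^sup>2 * \<beta> k / (real (Suc N))\<^sup>2"
      using arg_cong[OF choose_ratio_diff[of N k], of "\<lambda>x. x * \<beta> k"] by (simp add: algebra_simps)
  qed simp
  also have "\<dots> = (\<Sum>k=1..Suc N. choose_ratio N k * \<beta> k) + star_sum s (Suc N) / real (Suc N) ^ a"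
    unfolding sum.distrib using assms[of "Suc N"] by (simp only: sum_divide_distrib)
  also have "(\<Sum>k=1..Suc N. choose_ratio N k * \<beta> k) = star_sum (a # s) N"
    using Suc by (simp add: choose_ratio_eq_0)
  finally show ?case by simp
qed simp

text \<open>\<open>B\<close> holds the partial sums of the coefficients, \<open>B 0\<close> being
  the one at index 0, so \<open>B k + B (k - 1)\<close> is \<open>U\<close> applied to them.\<close>

lemma star_sum_Cons_1:
  assumes "\<And>N. N \<ge> 1 \<Longrightarrow>
      star_sum s N = B 0 + (\<Sum>k=1..N. choose_ratio N k * (B k - B (k - 1)))"
  shows "star_sum (1 # s) N = (\<Sum>k=1..N. choose_ratio N k * ((B k + B (k - 1)) / real k))"
proof (rule star_sum_ConsI)
  fix N :: nat assume N: "N \<ge> 1"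
  have "(\<Sum>k=1..N. choose_ratio N k * (real k)\<^sup>2 * ((B k + B (k - 1)) / real k))
      = (\<Sum>k=1..N. choose_ratio N k * real k * (B k + B (k - 1)))"
    by (intro sum.cong) (simp_all add: power2_eq_square)
  also have "\<dots> = real N * star_sum s N"
    unfolding choose_ratio_telescope_1 assms[OF N] ..
  finally show "star_sum s N / real N ^ 1
      = (\<Sum>k=1..N. choose_ratio N k * (real k)\<^sup>2 * ((B k + B (k - 1)) / real k)) / (real N)\<^sup>2"
    using N by (simp add: power2_eq_square)
qed

lemma star_sum_replicate_2:
  assumes "\<And>N. star_sum s N = (\<Sum>k=1..N. choose_ratio N k * \<alpha> k)"
  shows "star_sum (replicate e 2 @ s) N
    = (\<Sum>k=1..N. choose_ratio N k * (\<alpha> k / real k ^ (2 * e)))"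
proof (induction e arbitrary: N)
  case (Suc e)
  have "star_sum (2 # (replicate e 2 @ s)) N
      = (\<Sum>k=1..N. choose_ratio N k * (\<alpha> k / real k ^ (2 * Suc e)))"
  proof (rule star_sum_ConsI)
    fix N :: nat
    have "(\<Sum>k=1..N. choose_ratio N k * (real k)\<^sup>2 * (\<alpha> k / real k ^ (2 * Suc e)))
        = (\<Sum>k=1..N. choose_ratio N k * (\<alpha> k / real k ^ (2 * e)))"
      by (intro sum.cong) (simp_all add: power2_eq_square)
    then show "star_sum (replicate e 2 @ s) N / real N ^ 2
        = (\<Sum>k=1..N. choose_ratio N k * (real k)\<^sup>2 * (\<alpha> k / real k ^ (2 * Suc e))) / (real N)\<^sup>2"
      using Suc by simp
  qed
  then show ?case by simp
qed (simp add: assms)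

text \<open>The alternating telescoping extracts a factor \<open>N\<close> from
  \<open>star_sum s N\<close>, so dividing by \<open>N^3\<close> leaves the \<open>N^2\<close> that
  \<open>star_sum_ConsI\<close> asks for.\<close>

lemma star_sum_Cons_3:
  assumes "\<And>N. star_sum s N = (\<Sum>k=1..N. choose_ratio N k * ((-1) ^ k * real k * (B k - B (k - 1))))"
    and "B 0 = 0"
  shows "star_sum (3 # s) N
    = (\<Sum>k=1..N. choose_ratio N k * ((-1) ^ k / (real k)\<^sup>2 * (B k + B (k - 1))))"
proof (rule star_sum_ConsI)
  fix N :: nat assume N: "N \<ge> 1"
  have "(\<Sum>k=1..N. choose_ratio N k * (real k)\<^sup>2 * ((-1) ^ k / (real k)\<^sup>2 * (B k + B (k - 1))))
      = (\<Sum>k=1..N. choose_ratio N k * (-1) ^ k * (B k + B (k - 1)))"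
    by (intro sum.cong) simp_all
  moreover have "star_sum s N = real N * (\<Sum>k=1..N. choose_ratio N k * (-1) ^ k * (B k + B (k - 1)))"
    unfolding choose_ratio_telescope_2 assms by (simp add: assms(2) mult.assoc)
  ultimately show "star_sum s N / real N ^ 3
      = (\<Sum>k=1..N. choose_ratio N k * (real k)\<^sup>2 * ((-1) ^ k / (real k)\<^sup>2 * (B k + B (k - 1))))
        / (real N)\<^sup>2"
    using N by (simp add: power2_eq_square power3_eq_cube)
qed

subsection \<open>Alternating sums weighted by powers of two\<close>

text \<open>The sum of \<open>w\<^sub>1 k\<^sub>1 \<cdots> w\<^sub>r k\<^sub>r\<close> over \<open>N \<ge> k\<^sub>1 \<ge> \<dots> \<ge> k\<^sub>r \<ge> 1\<close>, each term being multiplied by \<open>2\<close>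
  to the number of distinct \<open>k\<^sub>i\<close>.\<close>

primrec wsum :: "(nat \<Rightarrow> real) list \<Rightarrow> nat \<Rightarrow> real" where
  "wsum [] N = 1"
| "wsum (w # ws) N = (\<Sum>k=1..N. w k * (wsum ws k + wsum ws (k - 1)))"

lemma wsum_Cons_0 [simp]: "wsum (w # ws) 0 = 0"
  by simp

lemma wsum_Cons_Suc:
  "wsum (w # ws) (Suc N) = wsum (w # ws) N + w (Suc N) * (wsum ws (Suc N) + wsum ws N)"
  by simp

lemma wsum_Cons_diff:
  "k \<ge> 1 \<Longrightarrow> wsum (w # ws) k - wsum (w # ws) (k - 1) = w k * (wsum ws k + wsum ws (k - 1))"
  by (cases k) simp_all

declare wsum.simps(2) [simp del]

lemma sum_diff_wsum: "(\<Sum>k=1..N. wsum ws k - wsum ws (k - 1)) = wsum ws N - wsum ws 0"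
  by (induction N) simp_all

text \<open>The convergent tail is bounded by some \<open>b\<close>, so the increments are at most
  \<open>2 * b / k^2\<close>. Convergence feeds the induction; absolute summability serves the
  passage to the limit.\<close>

lemma wsum_summable_convergent:
  assumes "\<And>w k. w \<in> set ws \<Longrightarrow> \<bar>w k\<bar> \<le> 1 / (real k)\<^sup>2"
  shows "summable (\<lambda>k. \<bar>wsum ws k - wsum ws (k - 1)\<bar>) \<and> convergent (wsum ws)"
  using assms
proof (induction ws)
  case Nil
  have "wsum [] = (\<lambda>_. 1)" by auto
  then show ?case by (simp add: convergent_const)
next
  case (Cons w ws)
  then have "Bseq (wsum ws)"
    by (intro convergent_imp_Bseq) simp
  then obtain b where b: "\<And>k. \<bar>wsum ws k\<bar> \<le> b"
    unfolding Bseq_def by auto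
  have bound: "\<bar>wsum (w # ws) k - wsum (w # ws) (k - 1)\<bar> \<le> 2 * b * inverse (real k ^ 2)" for k
  proof (cases "k \<ge> 1")
    case True
    have "\<bar>wsum ws k + wsum ws (k - 1)\<bar> \<le> 2 * b"
      using b[of k] b[of "k - 1"] by linarith
    then have "\<bar>w k\<bar> * \<bar>wsum ws k + wsum ws (k - 1)\<bar> \<le> 1 / (real k)\<^sup>2 * (2 * b)"
      by (intro mult_mono Cons.prems) auto
    then show ?thesis
      by (simp only: wsum_Cons_diff[OF True] abs_mult) (simp add: field_simps)
  next
    case False
    then have "k = 0" by simp
    then show ?thesis by simp
  qed
  have *: "summable (\<lambda>k. \<bar>wsum (w # ws) k - wsum (w # ws) (k - 1)\<bar>)"
  proof (rule summable_comparison_test')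
    show "summable (\<lambda>k. 2 * b * inverse (real k ^ 2))"
      by (intro summable_mult inverse_power_summable) simp
  qed (use bound in simp)
  then have "summable (\<lambda>k. wsum (w # ws) k - wsum (w # ws) (k - 1))"
    by (rule summable_rabs_cancel)
  then have "convergent (\<lambda>N. \<Sum>k<Suc N. wsum (w # ws) k - wsum (w # ws) (k - 1))"
    by (subst convergent_Suc_iff) (simp add: summable_iff_convergent)
  also have "(\<lambda>N. \<Sum>k<Suc N. wsum (w # ws) k - wsum (w # ws) (k - 1)) = wsum (w # ws)"
  proof
    fix N
    show "(\<Sum>k<Suc N. wsum (w # ws) k - wsum (w # ws) (k - 1)) = wsum (w # ws) N"
      by (induction N) simp_all
  qed
  finally show ?case using * by simp
qed

text \<open>The weight contributed by a block of \<open>e\<close> twos followed by 3 or by 1;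
  \<open>wt 0\<close> is the \<open>x\<close> of the overview.\<close>

definition wt :: "nat \<Rightarrow> nat \<Rightarrow> real" where
  "wt e k = (-1) ^ k / real k ^ (2 * e + 2)"

lemma abs_wt_le: "\<bar>wt e k\<bar> \<le> 1 / (real k)\<^sup>2"
proof (cases "k = 0")
  case False
  then have "real k ^ 2 \<le> real k ^ (2 * e + 2)"
    by (intro power_increasing) auto
  then show ?thesis using False by (simp add: wt_def abs_mult power_abs frac_le)
qed (simp add: wt_def)

text \<open>Odd powers keep the sign \<open>(-1) ^ k\<close>, so odd power sums of
  \<open>wt 0\<close> are again sums of a single weight.\<close>

lemma wt_0_power:
  assumes "odd i"
  shows "1 / real k ^ (2 * p) * wt 0 k ^ i = wt (i - 1 + p) k"
proof -
  have 1: "((-1) ^ k) ^ i = (-1 :: real) ^ k"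
    using assms by (cases "even k") simp_all
  have 2: "(real k ^ (2 * 0 + 2)) ^ i = real k ^ (2 * i)"
    by (simp add: power_mult power2_eq_square)
  have "2 * (i - 1 + p) + 2 = 2 * p + 2 * i"
    using odd_pos[OF assms] by simp
  then have 3: "real k ^ (2 * (i - 1 + p) + 2) = real k ^ (2 * p) * real k ^ (2 * i)"
    by (simp only: power_add)
  show ?thesis
    unfolding wt_def power_divide 1 2 3 by simp
qed

definition wlim :: "nat list \<Rightarrow> real" where
  "wlim es = lim (wsum (map wt es))"

lemma wsum_tendsto_wlim: "wsum (map wt es) \<longlonglongrightarrow> wlim es"
  unfolding wlim_def convergent_LIMSEQ_iff[symmetric]
  using wsum_summable_convergent[of "map wt es"] abs_wt_le by auto

text \<open>Dominated convergence for series (Tannery): the quotients tend to 1, are bounded by 1,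
  and vanish for \<open>k > N\<close>.\<close>

lemma choose_ratio_sum_tendsto:
  assumes "summable (\<lambda>k. \<bar>f k\<bar>)" "(\<lambda>N. \<Sum>k=1..N. f k) \<longlonglongrightarrow> L"
  shows "(\<lambda>N. \<Sum>k=1..N. choose_ratio N k * f k) \<longlonglongrightarrow> L"
proof -
  define g where "g = (\<lambda>k. if k = 0 then 0 else f k)"
  have summable: "summable (\<lambda>k. \<bar>g k\<bar>)"
    using assms(1) by (rule summable_comparison_test'[where N = 0]) (simp add: g_def)
  have "(\<lambda>N. \<Sum>k. choose_ratio N k * g k) \<longlonglongrightarrow> suminf g"
  proof (rule tannerys_theorem[THEN conjunct2, THEN conjunct2])
    show "((\<lambda>N. choose_ratio N k * g k) \<longlongrightarrow> g k) sequentially" for k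
      using tendsto_mult[OF tendsto_choose_ratio tendsto_const, of k "g k"] by simp
    have "norm (choose_ratio N k * g k) \<le> \<bar>g k\<bar>" for k N
      using abs_choose_ratio_le_1[of N k] by (simp add: abs_mult mult_left_le_one_le)
    then show "\<forall>\<^sub>F (k, N) in at_top \<times>\<^sub>F sequentially. norm (choose_ratio N k * g k) \<le> \<bar>g k\<bar>"
      by (intro always_eventually) auto
  qed (use summable in auto)
  also have "(\<lambda>N. \<Sum>k. choose_ratio N k * g k) = (\<lambda>N. \<Sum>k=1..N. choose_ratio N k * f k)"
  proof
    fix N
    have "(\<Sum>k. choose_ratio N k * g k) = (\<Sum>k=1..N. choose_ratio N k * g k)"
      by (intro suminf_finite) (auto simp: g_def choose_ratio_eq_0 not_le)
    then show "(\<Sum>k. choose_ratio N k * g k) = (\<Sum>k=1..N. choose_ratio N k * f k)"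
      by (simp add: g_def)
  qed
  also have "suminf g = L"
  proof (rule LIMSEQ_unique)
    have "(\<lambda>N. sum g {..N}) \<longlonglongrightarrow> suminf g"
      using summable_rabs_cancel[OF summable] by (rule summable_LIMSEQ')
    moreover have "sum g {..N} = (\<Sum>k=1..N. f k)" for N
      by (simp add: atMost_atLeast0 sum.atLeast_Suc_atMost g_def)
    ultimately show "(\<lambda>N. \<Sum>k=1..N. f k) \<longlonglongrightarrow> suminf g" by simp
  qed (rule assms(2))
  finally show ?thesis .
qed

section \<open>Zeta star values as limits of alternating sums\<close>

text \<open>The shape consumed by \<open>star_sum_Cons_1\<close>, with \<open>c\<close> times a
  weighted sum in the role of \<open>B\<close>; \<open>c\<close> carries the sign.\<close>

definition wsum_repr :: "nat list \<Rightarrow> real \<Rightarrow> nat list \<Rightarrow> bool" where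
  "wsum_repr s c es \<longleftrightarrow> (\<forall>N\<ge>1. star_sum s N = c * wsum (map wt es) 0 +
     (\<Sum>k=1..N. choose_ratio N k * (c * wsum (map wt es) k - c * wsum (map wt es) (k - 1))))"

lemma zeta_star_wsum_repr:
  assumes "wsum_repr s c es"
  shows "zeta_star s = c * wlim es"
proof (rule zeta_star_eqI)
  let ?B = "wsum (map wt es)"
  have "summable (\<lambda>k. \<bar>?B k - ?B (k - 1)\<bar>)"
    using wsum_summable_convergent[of "map wt es"] abs_wt_le by auto
  moreover have "(\<lambda>N. \<Sum>k=1..N. ?B k - ?B (k - 1)) \<longlonglongrightarrow> wlim es - ?B 0"
    unfolding sum_diff_wsum by (intro tendsto_intros wsum_tendsto_wlim)
  ultimately have "(\<lambda>N. c * ?B 0 + c * (\<Sum>k=1..N. choose_ratio N k * (?B k - ?B (k - 1))))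
      \<longlonglongrightarrow> c * ?B 0 + c * (wlim es - ?B 0)"
    by (intro tendsto_intros choose_ratio_sum_tendsto)
  then show "star_sum s \<longlonglongrightarrow> c * wlim es"
  proof (rule Lim_transform_eventually[where g = "star_sum s", THEN tendsto_eq_rhs])
    show "\<forall>\<^sub>F N in sequentially.
        c * ?B 0 + c * (\<Sum>k=1..N. choose_ratio N k * (?B k - ?B (k - 1))) = star_sum s N"
      using assms unfolding wsum_repr_def eventually_sequentially
      by (intro exI[of _ 1]) (auto simp: sum_distrib_left algebra_simps)
  qed (simp add: algebra_simps)
qed

lemma wsum_repr_Nil: "wsum_repr [] 1 []"
  by (simp add: wsum_repr_def)

text \<open>Before 2 is prefixed, the constant 1 is rewritten as an alternating sum over
  \<open>k \<ge> 1\<close>; this is the source of the sign -1.\<close>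

lemma wsum_repr_replicate_2: "wsum_repr (replicate (Suc e) 2) (-1) [e]"
proof -
  have "star_sum [2] N = (\<Sum>k=1..N. choose_ratio N k * (- 2 * (-1) ^ k / (real k)\<^sup>2))" for N
  proof (rule star_sum_ConsI)
    fix N :: nat assume N: "N \<ge> 1"
    have "real N * (\<Sum>k=1..N. choose_ratio N k * (-1) ^ k * 2) = real N * (- 1)"
      \<comment> \<open>For constant \<open>B\<close> the differences vanish and only
        \<open>- N * B 0\<close> remains.\<close>
      using choose_ratio_telescope_2[of N "\<lambda>_. 1"] by simp
    then have "(\<Sum>k=1..N. choose_ratio N k * (-1) ^ k * 2) = - 1"
      unfolding mult_cancel_left using N by simp
    moreover have "(\<Sum>k=1..N. choose_ratio N k * (real k)\<^sup>2 * (- 2 * (-1) ^ k / (real k)\<^sup>2))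
        = - (\<Sum>k=1..N. choose_ratio N k * (-1) ^ k * 2)"
      unfolding sum_negf[symmetric] by (intro sum.cong) simp_all
    ultimately show "star_sum [] N / real N ^ 2
       = (\<Sum>k=1..N. choose_ratio N k * (real k)\<^sup>2 * (- 2 * (-1) ^ k / (real k)\<^sup>2)) / (real N)\<^sup>2"
      by simp
  qed
  then have "star_sum (replicate e 2 @ [2]) N
      = (\<Sum>k=1..N. choose_ratio N k * (- 2 * (-1) ^ k / (real k)\<^sup>2 / real k ^ (2 * e)))" for N
    by (rule star_sum_replicate_2)
  then have *: "star_sum (replicate (Suc e) 2) N
      = (\<Sum>k=1..N. choose_ratio N k * (- 2 * (-1) ^ k / (real k)\<^sup>2 / real k ^ (2 * e)))" for N
    by (simp add: replicate_append_same)
  have "- 1 * wsum [wt e] k - - 1 * wsum [wt e] (k - 1) = - 2 * (-1) ^ k / (real k)\<^sup>2 / real k ^ (2 * e)"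
    if "k \<ge> 1" for k
    using wsum_Cons_diff[OF that, of "wt e" "[]"] by (simp add: wt_def power_add power2_eq_square mult.commute)
  then show ?thesis
    unfolding wsum_repr_def * by (auto intro!: sum.cong)
qed

lemma wsum_repr_31:
  assumes "wsum_repr s c es"
  shows "wsum_repr (replicate e 2 @ [3] @ replicate f 2 @ [1] @ s) c (e # f # es)"
proof -
  define A where "A = (\<lambda>k. c * wsum (map wt es) k)"
  define B where "B = (\<lambda>k. c * wsum (map wt (f # es)) k)"
  have B: "B k - B (k - 1) = wt f k * (A k + A (k - 1))" if "k \<ge> 1" for k
    using wsum_Cons_diff[OF that, of "wt f" "map wt es"] by (simp add: A_def B_def algebra_simps)
  have C: "c * wsum (map wt (e # f # es)) k - c * wsum (map wt (e # f # es)) (k - 1)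
      = wt e k * (B k + B (k - 1))" if "k \<ge> 1" for k
    using wsum_Cons_diff[OF that, of "wt e" "map wt (f # es)"] by (simp add: B_def algebra_simps)
  have "star_sum (1 # s) N = (\<Sum>k=1..N. choose_ratio N k * ((A k + A (k - 1)) / real k))" for N
    using assms unfolding wsum_repr_def by (intro star_sum_Cons_1) (simp add: A_def)
  then have "star_sum (replicate f 2 @ 1 # s) N
      = (\<Sum>k=1..N. choose_ratio N k * ((A k + A (k - 1)) / real k / real k ^ (2 * f)))" for N
    by (rule star_sum_replicate_2)
  \<comment> \<open>As \<open>1 / k ^ (2 * f + 1) = (-1) ^ k * k * wt f k\<close>, the coefficients
    take the form required before a 3.\<close>
  also have "\<dots> N = (\<Sum>k=1..N. choose_ratio N k * ((-1) ^ k * real k * (B k - B (k - 1))))" for N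
    by (intro sum.cong refl, subst B) (simp_all add: wt_def power_add power2_eq_square field_simps)
  finally have "star_sum (3 # replicate f 2 @ 1 # s) N
      = (\<Sum>k=1..N. choose_ratio N k * ((-1) ^ k / (real k)\<^sup>2 * (B k + B (k - 1))))" for N
    by (rule star_sum_Cons_3) (simp add: B_def)
  then have "star_sum (replicate e 2 @ 3 # replicate f 2 @ 1 # s) N
      = (\<Sum>k=1..N. choose_ratio N k *
          ((-1) ^ k / (real k)\<^sup>2 * (B k + B (k - 1)) / real k ^ (2 * e)))" for N
    by (rule star_sum_replicate_2)
  also have "\<dots> N = (\<Sum>k=1..N. choose_ratio N k *
      (c * wsum (map wt (e # f # es)) k - c * wsum (map wt (e # f # es)) (k - 1)))" for N
    by (intro sum.cong refl, subst C) (simp_all add: wt_def power_add power2_eq_square field_simps)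
  finally show ?thesis by (simp add: wsum_repr_def)
qed

lemma wsum_repr_rep31:
  assumes "wsum_repr s c es"
  shows "wsum_repr (rep31 j @ s) c (replicate (2 * j) 0 @ es)"
proof (induction j)
  case (Suc j)
  from wsum_repr_31[OF this, of 0 0] show ?case by simp
qed (simp add: assms)

lemma insert2_31_Suc:
  "insert2_31 (Suc n) (a # b # e) = replicate a 2 @ [3] @ replicate b 2 @ [1] @ insert2_31 n e"
  unfolding insert2_31_def upt_conv_Cons[OF zero_less_Suc] map_Suc_upt[symmetric] by (simp add: o_def)

lemma wsum_repr_insert2_31: "length e = 2 * n \<Longrightarrow> wsum_repr (insert2_31 n e) 1 e"
proof (induction n arbitrary: e)
  case 0
  then show ?case by (simp add: insert2_31_def wsum_repr_Nil)
next
  case (Suc n)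
  then obtain a b e' where e: "e = a # b # e'" "length e' = 2 * n"
    by (auto simp: length_Suc_conv)
  show ?case
    unfolding e(1) insert2_31_Suc by (intro wsum_repr_31 Suc.IH e(2))
qed

lemma zeta_star_replicate_2: "zeta_star (replicate (Suc e) 2) = - wlim [e]"
  using zeta_star_wsum_repr[OF wsum_repr_replicate_2] by simp

lemma zeta_star_rep31: "zeta_star (rep31 j) = wlim (replicate (2 * j) 0)"
  using zeta_star_wsum_repr[OF wsum_repr_rep31[OF wsum_repr_Nil]] by simp

lemma zeta_star_rep31_2: "zeta_star (rep31 j @ [2]) = - wlim (replicate (2 * j + 1) 0)"
  using zeta_star_wsum_repr[OF wsum_repr_rep31[OF wsum_repr_replicate_2[of 0]]]
  by (simp add: replicate_append_same)

lemma zeta_star_insert2_31: "length e = 2 * n \<Longrightarrow> zeta_star (insert2_31 n e) = wlim e"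
  using zeta_star_wsum_repr[OF wsum_repr_insert2_31] by simp

text \<open>Discrete product rule
  \<open>2 (a b - a' b') = (a - a') (b + b') + (b - b') (a + a')\<close>, with increments
  \<open>2 * u k\<close> and \<open>2 * v k\<close>.\<close>

lemma wsum_two_shuffle: "wsum [u, v] N + wsum [v, u] N = wsum [u] N * wsum [v] N"
  by (induction N) (simp_all add: wsum_Cons_Suc algebra_simps)

subsection \<open>Generating functions\<close>

text \<open>By multilinearity, the derivative of \<open>wsum (replicate r x) N\<close> in the
  direction \<open>y\<close>.\<close>

definition marked_sum :: "(nat \<Rightarrow> real) \<Rightarrow> (nat \<Rightarrow> real) \<Rightarrow> nat \<Rightarrow> nat \<Rightarrow> real" where
  "marked_sum x y r N = (\<Sum>i<r. wsum ((replicate r x)[i := y]) N)"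

lemma marked_sum_0 [simp]: "marked_sum x y r 0 = 0"
proof -
  have "wsum ((replicate r x)[i := y]) 0 = 0" if "i < r" for i
    using that by (cases r; cases i) simp_all
  then show ?thesis by (simp add: marked_sum_def)
qed

text \<open>Separates the mark in first position from the marks in the tail.\<close>

lemma marked_sum_Suc:
  "marked_sum x y (Suc r) (Suc N) = marked_sum x y (Suc r) N
     + y (Suc N) * (wsum (replicate r x) (Suc N) + wsum (replicate r x) N)
     + x (Suc N) * (marked_sum x y r (Suc N) + marked_sum x y r N)"
  unfolding marked_sum_def
  by (simp add: sum.lessThan_Suc_shift wsum_Cons_Suc sum.distrib sum_distrib_left algebra_simps
      del: sum.lessThan_Suc)

text \<open>With \<open>Q\<^sub>N = (\<Prod>k=1..N. (1 + x\<^sub>k t) / (1 - x\<^sub>k t))\<close>, the generating function of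
  \<open>wsum (replicate r x) N\<close>, this is the logarithmic derivative of \<open>Q\<^sub>N\<close> with respect to the
  derivation that maps \<open>x\<^sub>k\<close> to \<open>x\<^sub>k w\<^sub>k\<close>.\<close>

lemma marked_sum_eq:
  fixes x w :: "nat \<Rightarrow> real"
  shows "marked_sum x (\<lambda>k. x k * w k) r N
    = (\<Sum>i\<le>r. (if odd i then \<Sum>k=1..N. 2 * w k * x k ^ i else 0) * wsum (replicate (r - i) x) N)"
proof -
  define Q where "Q = (\<lambda>N. Abs_fps (\<lambda>r. wsum (replicate r x) N))"
  define S where "S = (\<lambda>N. Abs_fps (\<lambda>r. marked_sum x (\<lambda>k. x k * w k) r N))"
  \<comment> \<open>The derivation maps the logarithm of \<open>(1 + x t) / (1 - x t)\<close>, the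
    sum of \<open>2 x^i t^i / i\<close> over odd \<open>i\<close>, to the sum of
    \<open>2 w x^i t^i\<close>.\<close>
  define P where "P = (\<lambda>N. Abs_fps (\<lambda>i. if odd i then \<Sum>k=1..N. 2 * w k * x k ^ i else 0))"
  have "S N = P N * Q N"
  proof (induction N)
    case 0
    have "P 0 = 0" by (rule fps_ext) (auto simp: P_def)
    moreover have "S 0 = 0" by (rule fps_ext) (simp add: S_def)
    ultimately show ?case by simp
  next
    case (Suc N)
    \<comment> \<open>\<open>E / D\<close> is the new factor of \<open>Q\<close> and
      \<open>R = 2 T / (D E)\<close> the new summand of \<open>P\<close>; all relations are stated
      without division.\<close>
    define D where "D = 1 - fps_const (x (Suc N)) * fps_X"
    define E where "E = 1 + fps_const (x (Suc N)) * fps_X"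
    define T where "T = fps_const (x (Suc N) * w (Suc N)) * fps_X"
    define R where "R = Abs_fps (\<lambda>i. if odd i then 2 * w (Suc N) * x (Suc N) ^ i else 0)"
    have Q: "Q (Suc N) * D = Q N * E"
    proof (rule fps_ext)
      fix r
      show "fps_nth (Q (Suc N) * D) r = fps_nth (Q N * E) r"
        by (cases r) (simp_all add: Q_def D_def E_def wsum_Cons_Suc algebra_simps)
    qed
    have S: "S (Suc N) * D = S N * E + T * (Q N + Q (Suc N))"
    proof (rule fps_ext)
      fix r
      show "fps_nth (S (Suc N) * D) r = fps_nth (S N * E + T * (Q N + Q (Suc N))) r"
        by (cases r)
          (simp_all add: S_def Q_def D_def E_def T_def marked_sum_Suc marked_sum_def[of _ _ 0]
            algebra_simps)
    qed
    have P: "P (Suc N) = P N + R"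
      by (rule fps_ext) (simp add: P_def R_def)
    have "R * D * E = R - fps_const ((x (Suc N))\<^sup>2) * fps_X ^ 2 * R"
      by (simp add: D_def E_def algebra_simps power2_eq_square flip: fps_const_mult)
    also have "\<dots> = 2 * T"
    proof (rule fps_ext)
      fix r
      consider "r = 0" | "r = 1" | r' where "r = Suc (Suc r')"
        by (cases r; cases "r - 1") auto
      then show "fps_nth (R - fps_const ((x (Suc N))\<^sup>2) * fps_X ^ 2 * R) r = fps_nth (2 * T) r"
        by cases (simp_all add: R_def T_def fps_X_power_mult_nth mult.assoc numeral_fps_const
            power2_eq_square)
    qed
    finally have R: "R * D * E = 2 * T" .
    have DE: "D + E = 2" by (simp add: D_def E_def)
    \<comment> \<open>One \<open>D\<close> serves the recurrence for \<open>S\<close>, the other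
      that for \<open>Q\<close>; both are cancelled since \<open>D\<close> is nonzero.\<close>
    have "S (Suc N) * D * D = (P (Suc N) * Q (Suc N)) * D * D"
    proof -
      have "S (Suc N) * D * D = P N * Q N * E * D + T * (Q N * D + Q (Suc N) * D)"
        by (simp only: S Suc) (simp add: algebra_simps)
      also have "\<dots> = P N * Q N * E * D + T * Q N * (D + E)"
        by (simp only: Q) (simp add: algebra_simps)
      also have "\<dots> = P N * Q N * E * D + Q N * (R * D * E)"
        by (simp only: R DE) (simp add: algebra_simps)
      also have "\<dots> = P (Suc N) * (Q (Suc N) * D) * D"
        by (simp only: Q P) (simp add: algebra_simps)
      finally show ?thesis by (simp only: mult.assoc)
    qed
    moreover have "D \<noteq> 0"
    proof
      assume "D = 0"
      then have "fps_nth D 0 = 0" by simp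
      then show False by (simp add: D_def)
    qed
    ultimately show ?case by simp
  qed
  then have "fps_nth (S N) r = fps_nth (P N * Q N) r" by simp
  then show ?thesis
    by (simp add: S_def P_def Q_def fps_mult_nth atLeast0AtMost)
qed

lemma sum_odd_atMost:
  fixes g :: "nat \<Rightarrow> real"
  shows "(\<Sum>i\<le>2 * n + 1. (if odd i then g i else 0) * h i) = (\<Sum>k\<le>n. g (2 * k + 1) * h (2 * k + 1))"
  by (induction n) simp_all

lemma sum_pairs_eq:
  fixes f :: "nat \<Rightarrow> nat \<Rightarrow> real"
  shows "(\<Sum>(j, k)\<in>{(j, k). j + k = n}. f j k) = (\<Sum>k\<le>n. f (n - k) k)"
  by (rule sum.reindex_bij_witness[where i = "\<lambda>k. (n - k, k)" and j = snd]) auto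

text \<open>Lists of naturals with sum 1 are the unit vectors, so the sum over exponents becomes a
  marked sum.\<close>

lemma sum_unit_lists:
  fixes f :: "nat list \<Rightarrow> real"
  shows "(\<Sum>e\<in>{e. length e = r \<and> sum_list e = 1}. f e) = (\<Sum>i<r. f ((replicate r 0)[i := 1]))"
proof -
  have "{e. length e = r \<and> sum_list e = (1::nat)} = (\<lambda>i. (replicate r 0)[i := 1]) ` {..<r}"
  proof (induction r)
    case (Suc r)
    have "e \<in> {e. length e = Suc r \<and> sum_list e = (1::nat)} \<longleftrightarrow>
      e = 1 # replicate r 0 \<or> (\<exists>e'\<in>{e. length e = r \<and> sum_list e = (1::nat)}. e = 0 # e')" for e
    proof (cases e)
      case (Cons a e')
      consider "a = 0" | "a = 1" | "a \<ge> 2" by linarith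
      then show ?thesis
        using replicate_length_same[of e' 0] unfolding Cons by cases (auto)
    qed simp
    then have "{e. length e = Suc r \<and> sum_list e = (1::nat)}
        = insert (1 # replicate r 0) ((#) 0 ` {e. length e = r \<and> sum_list e = 1})"
      by blast
    then show ?case
      unfolding Suc lessThan_Suc_eq_insert_0 by (simp add: image_image)
  qed auto
  moreover have "inj_on (\<lambda>i. (replicate r (0::nat))[i := 1]) {..<r}"
  proof (rule inj_onI)
    fix i j assume "i \<in> {..<r}" "j \<in> {..<r}" "(replicate r (0::nat))[i := 1] = (replicate r 0)[j := 1]"
    then have "(replicate r (0::nat))[i := 1] ! i = (replicate r 0)[j := 1] ! i" by simp
    with \<open>i \<in> {..<r}\<close> \<open>j \<in> {..<r}\<close> show "i = j"
      by (simp add: nth_list_update split: if_splits)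
  qed
  ultimately show ?thesis by (simp add: sum.reindex)
qed

section \<open>Limits of the identities and the theorem\<close>

lemma wlim_two: "wlim [m, n] + wlim [n, m] = wlim [m] * wlim [n]"
proof (rule LIMSEQ_unique)
  show "(\<lambda>N. wsum (map wt [m, n]) N + wsum (map wt [n, m]) N) \<longlonglongrightarrow> wlim [m, n] + wlim [n, m]"
    by (intro tendsto_intros wsum_tendsto_wlim)
  show "(\<lambda>N. wsum (map wt [m, n]) N + wsum (map wt [n, m]) N) \<longlonglongrightarrow> wlim [m] * wlim [n]"
    unfolding list.map wsum_two_shuffle
    using tendsto_mult[OF wsum_tendsto_wlim[of "[m]"] wsum_tendsto_wlim[of "[n]"]] by simp
qed

text \<open>The limit of \<open>marked_sum_eq\<close> for \<open>x = wt 0\<close> and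
  \<open>w k = 1 / k ^ (2 * p)\<close>; \<open>p = 0\<close> yields the second identity,
  \<open>p = 1\<close> the third.\<close>

lemma sum_wlim_list_update:
  "(\<Sum>i<r. wlim ((replicate r 0)[i := p]))
    = (\<Sum>i\<le>r. (if odd i then wlim [i - 1 + p] else 0) * wlim (replicate (r - i) 0))"
proof (rule LIMSEQ_unique)
  show "(\<lambda>N. \<Sum>i<r. wsum (map wt ((replicate r 0)[i := p])) N)
      \<longlonglongrightarrow> (\<Sum>i<r. wlim ((replicate r 0)[i := p]))"
    by (intro tendsto_intros wsum_tendsto_wlim)
  have wt: "wt p = (\<lambda>k. wt 0 k * (1 / real k ^ (2 * p)))"
    by (auto simp: wt_def power_add)
  have odd: "(\<Sum>k=1..N. 2 * (1 / real k ^ (2 * p)) * wt 0 k ^ i) = wsum (map wt [i - 1 + p]) N"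
    if "odd i" for i N
    by (simp only: mult.assoc wt_0_power[OF that]) (simp add: wsum.simps(2) mult.commute)
  have eq: "(\<Sum>i<r. wsum (map wt ((replicate r 0)[i := p])) N)
      = (\<Sum>i\<le>r. (if odd i then wsum (map wt [i - 1 + p]) N else 0)
          * wsum (map wt (replicate (r - i) 0)) N)" for N
  proof -
    have "(\<Sum>i<r. wsum (map wt ((replicate r 0)[i := p])) N) = marked_sum (wt 0) (wt p) r N"
      by (simp add: marked_sum_def map_update)
    also have "\<dots> = (\<Sum>i\<le>r. (if odd i then wsum (map wt [i - 1 + p]) N else 0)
          * wsum (map wt (replicate (r - i) 0)) N)"
      by (subst wt, subst marked_sum_eq) (intro sum.cong refl, use odd in auto)
    finally show ?thesis .
  qed
  have "(\<lambda>N. if odd i then wsum (map wt [i - 1 + p]) N else 0)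
      \<longlonglongrightarrow> (if odd i then wlim [i - 1 + p] else 0)" for i
    using wsum_tendsto_wlim[of "[i - 1 + p]"] by simp
  then show "(\<lambda>N. \<Sum>i<r. wsum (map wt ((replicate r 0)[i := p])) N) \<longlonglongrightarrow>
     (\<Sum>i\<le>r. (if odd i then wlim [i - 1 + p] else 0) * wlim (replicate (r - i) 0))"
    unfolding eq by (intro tendsto_intros wsum_tendsto_wlim)
qed

theorem theorem9p1:
  fixes m n :: nat
  shows "(zeta_star (replicate n 2 @ [3] @ replicate m 2 @ [1])
           + zeta_star (replicate m 2 @ [3] @ replicate n 2 @ [1])
         = zeta_star (replicate (n + 1) 2) * zeta_star (replicate (m + 1) 2))
    \<and> ((2 * real n + 1) * zeta_star (rep31 n @ [2])
         = (\<Sum>(j, k)\<in>{(j, k). j + k = n}. zeta_star (rep31 j) * zeta_star (replicate (2 * k + 1) 2)))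
    \<and> (n \<ge> 1 \<longrightarrow>
         (\<Sum>e\<in>{e :: nat list. length e = 2 * n \<and> sum_list e = 1}. zeta_star (insert2_31 n e))
         = (\<Sum>(j, k)\<in>{(j, k). j + k = n - 1}. zeta_star (rep31 j @ [2]) * zeta_star (replicate (2 * k + 2) 2)))"
proof (intro conjI impI)
  have "zeta_star (replicate a 2 @ [3] @ replicate b 2 @ [1]) = wlim [a, b]" for a b
    using zeta_star_wsum_repr[OF wsum_repr_31[OF wsum_repr_Nil]] by simp
  then show "zeta_star (replicate n 2 @ [3] @ replicate m 2 @ [1])
           + zeta_star (replicate m 2 @ [3] @ replicate n 2 @ [1])
         = zeta_star (replicate (n + 1) 2) * zeta_star (replicate (m + 1) 2)"
    using wlim_two[of n m] zeta_star_replicate_2 by simp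
next
  \<comment> \<open>For \<open>p = 0\<close> the mark is invisible, so the marked sum is
    \<open>2 * n + 1\<close> equal terms.\<close>
  have upd: "(replicate r (0::nat))[i := 0] = replicate r 0" for r i
    by (induction r arbitrary: i) (simp_all split: nat.split)
  have "(2 * real n + 1) * wlim (replicate (2 * n + 1) 0)
      = (\<Sum>i<2 * n + 1. wlim ((replicate (2 * n + 1) 0)[i := 0]))"
    unfolding upd by simp
  also have "\<dots> = (\<Sum>k\<le>n. wlim [2 * k] * wlim (replicate (2 * (n - k)) 0))"
    unfolding sum_wlim_list_update sum_odd_atMost by (simp add: diff_mult_distrib2)
  finally show "(2 * real n + 1) * zeta_star (rep31 n @ [2])
      = (\<Sum>(j, k)\<in>{(j, k). j + k = n}. zeta_star (rep31 j) * zeta_star (replicate (2 * k + 1) 2))"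
    using zeta_star_replicate_2
    unfolding sum_pairs_eq zeta_star_rep31 zeta_star_rep31_2
    by (simp add: sum_negf mult.commute)
next
  assume "n \<ge> 1"
  then obtain l where n: "n = Suc l" by (cases n) auto
  have eq: "2 * Suc l - (2 * k + 1) = 2 * (l - k) + 1" if "k \<le> l" for k
    using that by simp
  have "(\<Sum>e | length e = 2 * n \<and> sum_list e = 1. zeta_star (insert2_31 n e))
      = (\<Sum>e | length e = 2 * n \<and> sum_list e = 1. wlim e)"
    by (intro sum.cong) (auto simp: zeta_star_insert2_31)
  also have "\<dots> = (\<Sum>i\<le>2 * n. (if odd i then wlim [i - 1 + 1] else 0) * wlim (replicate (2 * n - i) 0))"
    unfolding sum_unit_lists sum_wlim_list_update ..
  \<comment> \<open>The top index \<open>2 * n\<close> is even and contributes 0.\<close>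
  also have "\<dots> = (\<Sum>i\<le>2 * l + 1. (if odd i then wlim [i - 1 + 1] else 0) * wlim (replicate (2 * n - i) 0))"
    by (simp add: n)
  also have "\<dots> = (\<Sum>k\<le>l. wlim [2 * k + 1] * wlim (replicate (2 * (l - k) + 1) 0))"
    unfolding sum_odd_atMost n by (intro sum.cong refl) (simp add: eq[simplified])
  finally show "(\<Sum>e | length e = 2 * n \<and> sum_list e = 1. zeta_star (insert2_31 n e))
      = (\<Sum>(j, k)\<in>{(j, k). j + k = n - 1}.
          zeta_star (rep31 j @ [2]) * zeta_star (replicate (2 * k + 2) 2))"
    \<comment> \<open>Both factors on the right carry a minus sign, and the signs cancel.\<close>
    using zeta_star_replicate_2[of "2 * _ + 1"]
    unfolding sum_pairs_eq zeta_star_rep31_2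
    by (simp add: n mult.commute)
qed

end
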